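(* For every admissible return path $P$ in the 128-state system (defined in the context), $\mathrm{Net\_Budget}(P)\le 0$.
   Context: Extended states. An extended state is a tuple $\Sigma'=(B,s_b,s_c,s_a,s_q,s_r)$ with $B\in\{1,\dots,8\}$, $s_b=B\bmod 2$, $s_c=\lfloor B/2\rfloor \bmod 2$ (so $s_b,s_c$ are determined by $B$) and $s_a,s_q,s_r\in\{0,1\}$. For a positive integer $h=B+8(A-1)$ with $B\in\{1,\dots,8\}$, $A\ge1$, the bits represent $s_a=A\bmod 2$, $s_q=\lfloor A/2\rfloor\bmod 2$, $s_r=\lfloor A/4\rfloor \bmod 2$. Admissible transitions (the "128-state system": $64$ tuples times two outcome labels $j\in\{0,1\}$, i.e. 128 tabulated cases). From the state with data $(B,s_a,s_q,s_r)$ there is, for each $j\in\{0,1\}$, one admissible transition to the state with data $(B',s_a',s_q',s_r')$, where $B'$ is given by: if $s_a=1$: $1\mapsto 2$, $2\mapsto 1$, $3\mapsto 5$, $4\mapsto 2$, $5\mapsto 8$, $6\mapsto 3$, $7\mapsto 3$, $8\mapsto 4$; if $s_a=0$: $1\mapsto 6$, $2\mapsto 5$, $3\mapsto 1$, $4\mapsto 6$, $5\mapsto 4$, $6\mapsto 7$, $7\mapsto 7$, $8\mapsto 8$; and $(s_a',s_q',s_r')=(s_q,s_r,j)$ if $s_a=0$, $(s_a',s_q',s_r')=(j,j,j)$ if $s_a=1$. Return paths. The base-7 persistence set is the set of states with $B=7$ and $s_a=0$. An admissible return path is a finite path of admissible transitions such that (i) the initial transition is the forced exit $7\to3$ (source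 state has $B=7$, $s_a=1$), (ii) the terminal transition is the re-entry $6\to 7$ (source state has $B=6$, $s_a=0$), and (iii) no intermediate state lies in the base-7 persistence set. Budget. For a transition $e$ with source state having base $B$ and octave parity $s_a$: $\nu_2\_\mathrm{consumed}(e)=1$ if $B\in\{2,4,6,8\}$ (an even-base halving step) and $0$ otherwise; $\nu_2\_\mathrm{generated}(e)=1$ if $B$ is odd and $s_a=1$ (an odd step with $A$ odd) and $0$ otherwise. For a return path $P$, with sums over all its transitions, $$\mathrm{Net\_Budget}(P)=\sum_{e\in P}\nu_2\_\mathrm{generated}(e)-\sum_{e\in P}\nu_2\_\mathrm{consumed}(e)-1 .$$ *)

theory Defs
  imports Main
begin

record ext_state =
  base :: nat
  s_b :: nat
  s_c :: nat
  s_a :: nat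
  s_q :: nat
  s_r :: nat

definition mk_state :: "nat \<Rightarrow> nat \<Rightarrow> nat \<Rightarrow> nat \<Rightarrow> ext_state" where
  "mk_state B a q r =
     \<lparr>base = B, s_b = B mod 2, s_c = (B div 2) mod 2, s_a = a, s_q = q, s_r = r\<rparr>"

definition ext_states :: "ext_state set" where
  "ext_states = {mk_state B a q r | B a q r.
     B \<in> {1..8} \<and> a \<in> {0, 1} \<and> q \<in> {0, 1} \<and> r \<in> {0, 1}}"

(* Position B - 1 of each list holds the successor of base B. *)
definition next_base :: "nat \<Rightarrow> nat \<Rightarrow> nat" where
  "next_base a B =
     (if a = 1 then [2, 1, 5, 2, 8, 3, 3, 4] else [6, 5, 1, 6, 4, 7, 7, 8]) ! (B - 1)"

definition next_state :: "nat \<Rightarrow> ext_state \<Rightarrow> ext_state" where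
  "next_state j s =
     (if s_a s = 1
      then mk_state (next_base (s_a s) (base s)) j j j
      else mk_state (next_base (s_a s) (base s)) (s_q s) (s_r s) j)"

record transition =
  source :: ext_state
  outcome :: nat
  target :: ext_state

definition admissible_transitions :: "transition set" where
  "admissible_transitions =
     {\<lparr>source = s, outcome = j, target = next_state j s\<rparr> | s j. s \<in> ext_states \<and> j \<in> {0, 1}}"

definition admissible_path :: "transition list \<Rightarrow> bool" where
  "admissible_path P \<longleftrightarrow> P \<noteq> [] \<and> set P \<subseteq> admissible_transitions \<and>
     (\<forall>i. Suc i < length P \<longrightarrow> target (P ! i) = source (P ! Suc i))"

definition base7_persistence :: "ext_state set" where
  "base7_persistence = {s \<in> ext_states. base s = 7 \<and> s_a s = 0}"

(* The intermediate states are the targets of all transitions but the last. They may include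
   states with base 7 and s_a = 1, and no condition is put on the bits of the final state. *)
definition admissible_return_path :: "transition list \<Rightarrow> bool" where
  "admissible_return_path P \<longleftrightarrow> admissible_path P \<and>
     base (source (hd P)) = 7 \<and> s_a (source (hd P)) = 1 \<and> base (target (hd P)) = 3 \<and>
     base (source (last P)) = 6 \<and> s_a (source (last P)) = 0 \<and> base (target (last P)) = 7 \<and>
     (\<forall>e \<in> set (butlast P). target e \<notin> base7_persistence)"

definition nu2_consumed :: "transition \<Rightarrow> int" where
  "nu2_consumed e = (if base (source e) \<in> {2, 4, 6, 8} then 1 else 0)"

definition nu2_generated :: "transition \<Rightarrow> int" where
  "nu2_generated e = (if odd (base (source e)) \<and> s_a (source e) = 1 then 1 else 0)"

definition Net_Budget :: "transition list \<Rightarrow> int" where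
  "Net_Budget P = (\<Sum>e\<leftarrow>P. nu2_generated e) - (\<Sum>e\<leftarrow>P. nu2_consumed e) - 1"

end

theory Submission
  imports Defs
begin

text \<open>
  Only the bases matter. Forget the bits, so that every base may leave along either of its two
  arrows, and give an arrow the length consumed minus generated. Although the odd arrows with
  \<open>s_a = 1\<close> have length \<open>-1\<close>, the resulting graph on \<open>{1..8}\<close> has no cycle of negative length;
  this is certified by the shortest-path distances to base 7 (\<open>dist7\<close>), which satisfy the
  triangle inequality along each of the sixteen arrows (\<open>transition_budget_le\<close>). Summing the
  triangle inequality along a path telescopes (\<open>path_budget_le\<close>). A return path starts and ends at
  base 7, at distance 0 from itself, so it generates at most what it consumes, and the final
  \<open>-1\<close> in the budget only helps: in fact the net budget is at most \<open>-1\<close>.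
\<close>

text \<open>
  The length of a shortest path to base 7. For example, \<open>8 \<rightarrow> 4 \<rightarrow> 6 \<rightarrow> 7\<close> has three
  halving steps, while \<open>5 \<rightarrow> 8\<close> gains one unit back.
\<close>
definition dist7 :: "nat \<Rightarrow> int" where
  "dist7 B = [1, 2, 1, 2, 2, 1, 0, 3] ! (B - 1)"

text \<open>
  The triangle inequality for distances to base 7, one arrow at a time. It is tight, for instance,
  along the whole circuit \<open>7 \<rightarrow> 3 \<rightarrow> 5 \<rightarrow> 8 \<rightarrow> 4 \<rightarrow> 6 \<rightarrow> 7\<close> of length 0.
\<close>
lemma transition_budget_le:
  assumes "e \<in> admissible_transitions"
  shows "nu2_generated e - nu2_consumed e
    \<le> dist7 (base (target e)) - dist7 (base (source e))"
proof -
  obtain B a q r j where B: "B \<in> {1..8}" and a: "a \<in> {0, 1}"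
    and e: "e = \<lparr>source = mk_state B a q r, outcome = j, target = next_state j (mk_state B a q r)\<rparr>"
    using assms unfolding admissible_transitions_def ext_states_def by blast
  have "B \<in> {1, 2, 3, 4, 5, 6, 7, 8}"
    using B by auto
  then show ?thesis
    using a unfolding e
    by (auto simp: nu2_generated_def nu2_consumed_def next_state_def next_base_def mk_state_def
        dist7_def)
qed

lemma admissible_path_Cons_Cons:
  assumes "admissible_path (e # f # P)"
  shows "target e = source f" and "admissible_path (f # P)"
  using assms unfolding admissible_path_def by fastforce+

lemma path_budget_le:
  assumes "admissible_path P"
  shows "(\<Sum>e\<leftarrow>P. nu2_generated e) - (\<Sum>e\<leftarrow>P. nu2_consumed e)
    \<le> dist7 (base (target (last P))) - dist7 (base (source (hd P)))"
  using assms
proof (induction P rule: induct_list012)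
  case 1
  then show ?case by (simp add: admissible_path_def)
next
  case (2 e)
  then show ?case using transition_budget_le[of e] by (simp add: admissible_path_def)
next
  case (3 e f P)
  have "e \<in> admissible_transitions"
    using "3.prems" by (simp add: admissible_path_def)
  from transition_budget_le[OF this] "3.IH"(2)[OF admissible_path_Cons_Cons(2)[OF "3.prems"]]
  show ?case
    using admissible_path_Cons_Cons(1)[OF "3.prems"] by simp
qed

theorem proposition9p6p6:
  fixes P :: "transition list"
  assumes "admissible_return_path P"
  shows "Net_Budget P \<le> 0"
proof -
  have "admissible_path P" "base (source (hd P)) = 7" "base (target (last P)) = 7"
    using assms by (auto simp: admissible_return_path_def)
  then show ?thesis
    using path_budget_le[of P] by (simp add: Net_Budget_def)
qed

end
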